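(* For any $\mathbf{n}\in\mathbb{Z}^2\setminus\{\mathbf{0}\}$, $$\mathsf{E}\left\{\overrightarrow{f}(\mathbf{n})\right\}=2^{d_0(\mathbf{n})-2}\,\mathsf{E}\left\{\overrightarrow{f}[\mathcal{X}(\mathbf{n})]\right\}=\frac{2-d_0(\mathbf{n})}{4},$$ $$\mathsf{E}\left\{\overleftarrow{f}(\mathbf{n})\right\}=2^{d_0(\mathbf{n})-2}\,\mathsf{E}\left\{\overleftarrow{f}[\mathcal{X}(\mathbf{n})]\right\}=\frac{2+d_0(\mathbf{n})}{4},$$ and $$\mathsf{E}\left\{f(\mathbf{n})\right\}=2^{d_0(\mathbf{n})-2}\,\mathsf{E}\left\{f[\mathcal{X}(\mathbf{n})]\right\}=1.$$
   Context: Let $(\mathbf{S}_t)_{t\ge 0}$ be the simple random walk in $\mathbb{Z}^2$: $\mathbf{S}_0=\mathbf{0}$ and $\mathbf{S}_t=\mathbf{S}_{t-1}+\mathbf{e}_t$ for $t\geq 1$, where the $\mathbf{e}_t$ are independent and each is uniformly distributed on $\{\pm\mathbf{1}_1,\pm\mathbf{1}_2\}$ ($\mathbf{1}_i$ is the $i$th standard unit vector). Let $\tau$ be the first time $t\geq 1$ with $\mathbf{S}_t=\mathbf{0}$ (finite with probability 1). For $\mathbf{n}=(n^{(1)},n^{(2)})$ put $\|\mathbf{n}\|=|n^{(1)}|+|n^{(2)}|$, $|\mathbf{n}|=(|n^{(1)}|,|n^{(2)}|)$, let $d_0(\mathbf{n})$ be the number of zero components of $\mathbf{n}$, and let $\mathcal{X}(\mathbf{n})=\{\mathbf{m}\in\mathbb{Z}^2:|\mathbf{m}|=|\mathbf{n}|\}$.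 For a finite set $\mathcal{Z}\subset\mathbb{Z}^2$ all of whose elements have the same nonzero norm $\|\mathcal{Z}\|$: $f(\mathcal{Z})$ is the number of times $t$ with $0<t<\tau$ and $\mathbf{S}_t\in\mathcal{Z}$; $\overrightarrow{f}(\mathcal{Z})$ is the number of those times with in addition $\|\mathbf{S}_{t-1}\|=\|\mathcal{Z}\|-1$; $\overleftarrow{f}(\mathcal{Z})$ is the number of those times with in addition $\|\mathbf{S}_{t-1}\|=\|\mathcal{Z}\|+1$. For a single state, $f(\mathbf{n})=f(\{\mathbf{n}\})$, and similarly for $\overrightarrow{f}(\mathbf{n})$ and $\overleftarrow{f}(\mathbf{n})$. *)

theory Defs
  imports "HOL-Probability.Probability"
begin

definition unit_steps :: "(int ^ 2) set" where
  "unit_steps = (\<Union>i. {axis i 1, - axis i 1})"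

lemma finite_unit_steps: "finite unit_steps" and unit_steps_nonempty: "unit_steps \<noteq> {}"
  by (auto simp: unit_steps_def)

text \<open>The increment at time t is e t for t \<ge> 1; the value e 0 is never used.\<close>

locale simple_random_walk = prob_space M for M :: "'a measure" +
  fixes e :: "nat \<Rightarrow> 'a \<Rightarrow> int ^ 2"
  assumes indep_steps: "indep_vars (\<lambda>_. count_space UNIV) e {1..}"
    and uniform_steps:
      "\<And>t. t \<ge> 1 \<Longrightarrow> distr M (count_space UNIV) (e t) = measure_pmf (pmf_of_set unit_steps)"

primrec walk :: "(nat \<Rightarrow> 'a \<Rightarrow> int ^ 2) \<Rightarrow> 'a \<Rightarrow> nat \<Rightarrow> int ^ 2" where
  "walk e \<omega> 0 = 0"
| "walk e \<omega> (Suc t) = walk e \<omega> t + e (Suc t) \<omega>"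

definition l1_norm :: "int ^ 2 \<Rightarrow> int" where
  "l1_norm n = (\<Sum>i\<in>UNIV. \<bar>n $ i\<bar>)"

definition abs_vec :: "int ^ 2 \<Rightarrow> int ^ 2" where
  "abs_vec n = (\<chi> i. \<bar>n $ i\<bar>)"

definition zero_count :: "int ^ 2 \<Rightarrow> nat" where
  "zero_count n = card {i. n $ i = 0}"

definition sign_class :: "int ^ 2 \<Rightarrow> (int ^ 2) set" where
  "sign_class n = {m. abs_vec m = abs_vec n}"

text \<open>The common norm of the elements of a nonempty set on which the norm is constant;
  unspecified for other sets.\<close>

definition set_norm :: "(int ^ 2) set \<Rightarrow> int" where
  "set_norm Z = (THE r. \<forall>z\<in>Z. l1_norm z = r)"

text \<open>The functionals below act on a single path x. The first return time is \<infinity> if the path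
  never returns to the origin.\<close>

definition return_time :: "(nat \<Rightarrow> int ^ 2) \<Rightarrow> enat" where
  "return_time x = Inf (enat ` {t. t \<ge> 1 \<and> x t = 0})"

text \<open>Counting measure makes the number of visits \<infinity>, rather than 0, when there are
  infinitely many of them.\<close>

definition visits :: "(nat \<Rightarrow> int ^ 2) \<Rightarrow> (int ^ 2) set \<Rightarrow> ennreal" where
  "visits x Z = emeasure (count_space UNIV)
     {t. 0 < t \<and> enat t < return_time x \<and> x t \<in> Z}"

definition outward_visits :: "(nat \<Rightarrow> int ^ 2) \<Rightarrow> (int ^ 2) set \<Rightarrow> ennreal" where
  "outward_visits x Z = emeasure (count_space UNIV)
     {t. 0 < t \<and> enat t < return_time x \<and> x t \<in> Z \<and> l1_norm (x (t - 1)) = set_norm Z - 1}"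

definition inward_visits :: "(nat \<Rightarrow> int ^ 2) \<Rightarrow> (int ^ 2) set \<Rightarrow> ennreal" where
  "inward_visits x Z = emeasure (count_space UNIV)
     {t. 0 < t \<and> enat t < return_time x \<and> x t \<in> Z \<and> l1_norm (x (t - 1)) = set_norm Z + 1}"

end

theory Submission imports Defs begin

text \<open>The expected numbers of visits satisfy, up to any finite time, the recursion of hitting
  probabilities, so they are at most 1 and their limit, with value 1 at the origin, is harmonic off
  the origin. Recurrence makes it harmonic at the origin too, and a harmonic function attaining its
  maximum is constant; hence every state is visited once on average. A visit by a step
  \<open>u\<close> to \<open>n\<close> comes from \<open>n - u\<close>, so the outward and inward visits are counted by the neighbours
  of \<open>n\<close> of smaller and larger norm.\<close>

section \<open>The four unit steps\<close>

lemma sum_unit_steps: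
  "sum f unit_steps = f (axis 1 1) + f (- axis 1 1) + f (axis 2 1) + f (- axis 2 1)"
proof -
  let ?us = "[axis 1 1, - axis 1 1, axis 2 1, - axis 2 1 :: int ^ 2]"
  have "unit_steps = set ?us"
    by (auto simp: unit_steps_def UNIV_2)
  moreover have "distinct ?us"
    by (simp add: vec_eq_iff forall_2 axis_def)
  ultimately have "sum f unit_steps = sum_list (map f ?us)"
    by (metis sum.distinct_set_conv_list)
  then show ?thesis
    by (simp add: add.assoc)
qed

lemma card_unit_steps: "card unit_steps = 4"
  using sum_unit_steps[of "\<lambda>_. 1 :: nat"] by simp

section \<open>Return probabilities\<close>

text \<open>The law after \<open>t\<close> steps of the simple symmetric walk on the integers
  started at 0.\<close>

primrec line_prob :: "nat \<Rightarrow> int \<Rightarrow> real" where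
  "line_prob 0 k = of_bool (k = 0)"
| "line_prob (Suc t) k = (line_prob t (k - 1) + line_prob t (k + 1)) / 2"

text \<open>The law of the planar walk without killing. It enters through recurrence alone, by
  comparison with \<open>taboo_prob\<close>, so it is a recursion on numbers.\<close>

primrec step_prob :: "nat \<Rightarrow> int ^ 2 \<Rightarrow> real" where
  "step_prob 0 x = of_bool (x = 0)"
| "step_prob (Suc t) x = (\<Sum>u\<in>unit_steps. step_prob t (x - u)) / 4"

lemma line_prob_eq_0: "k < - int t \<Longrightarrow> line_prob t k = 0"
  by (induction t arbitrary: k) auto

text \<open>Position \<open>2 * j - t\<close> means \<open>j\<close> steps up, and the recursion of
  \<open>line_prob\<close> is Pascal's rule.\<close>

lemma line_prob_binomial: "line_prob t (2 * int j - int t) = (t choose j) / 2 ^ t"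
proof (induction t arbitrary: j)
  case 0
  then show ?case by (cases j) auto
next
  case (Suc t)
  have plus: "line_prob t (2 * int j - int (Suc t) + 1) = (t choose j) / 2 ^ t"
    using Suc[of j] by (simp add: algebra_simps)
  show ?case
  proof (cases j)
    case 0
    \<comment> \<open>The other neighbour, \<open>- t - 2\<close>, is out of reach in
      \<open>t\<close> steps.\<close>
    then show ?thesis
      using plus by (simp add: line_prob_eq_0)
  next
    case (Suc i)
    have "line_prob t (2 * int j - int (Suc t) - 1) = (t choose i) / 2 ^ t"
      using Suc.IH[of i] Suc by (simp add: algebra_simps)
    with plus Suc show ?thesis
      by (simp add: field_simps)
  qed
qed

text \<open>The factor is a quarter of the ratio of consecutive central binomial
  coefficients.\<close>

lemma line_prob_double_Suc:
  "line_prob (2 * Suc t) 0 = (2 * t + 1) / (2 * t + 2) * line_prob (2 * t) 0"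
proof -
  have eq: "line_prob (2 * k) 0 = real ((2 * k) choose k) / 4 ^ k" for k
    using line_prob_binomial[of "2 * k" k] by (simp add: power_mult)
  \<comment> \<open>Two absorption identities, multiplied together to avoid division in the
    naturals.\<close>
  have "Suc t * Suc t * ((2 * Suc t) choose Suc t) = (2 * t + 2) * (2 * t + 1) * ((2 * t) choose t)"
  proof -
    have "Suc t * ((2 * Suc t) choose Suc t) = (2 * t + 2) * ((2 * t + 1) choose t)"
      using Suc_times_binomial_eq[of "2 * t + 1" t] by (simp add: mult.commute)
    moreover have "Suc t * ((2 * t + 1) choose t) = (2 * t + 1) * ((2 * t) choose t)"
      using binomial_absorb_comp[of "2 * t + 1" t] by simp
    ultimately show ?thesis
      by (metis mult.assoc mult.left_commute)
  qed
  then have "real (Suc t * Suc t * ((2 * Suc t) choose Suc t))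
      = real ((2 * t + 2) * (2 * t + 1) * ((2 * t) choose t))"
    by (rule arg_cong)
  then have "(real t + 1) * ((real t + 1) * real ((2 * Suc t) choose Suc t))
      = (real t + 1) * (2 * (2 * real t + 1) * real ((2 * t) choose t))"
    by (simp add: algebra_simps del: binomial_Suc_Suc)
  then have "(real t + 1) * real ((2 * Suc t) choose Suc t) = 2 * (2 * real t + 1) * real ((2 * t) choose t)"
    by (subst (asm) mult_cancel_left) linarith
  then have "real ((2 * Suc t) choose Suc t) = 2 * (2 * real t + 1) * real ((2 * t) choose t) / (real t + 1)"
    by (simp add: eq_divide_eq mult.commute del: binomial_Suc_Suc)
  then show ?thesis
    unfolding eq by (simp add: divide_simps del: binomial_Suc_Suc) (simp add: algebra_simps del: binomial_Suc_Suc)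
qed

text \<open>An elementary substitute for Stirling's formula: equality holds after 2 steps, and the
  ratio passes the bound on because \<open>4 * s * (s + 1) \<le> (2 * s + 1)^2\<close>.\<close>

lemma line_prob_sqr_ge: "1 / (4 * real (Suc t)) \<le> (line_prob (2 * Suc t) 0)\<^sup>2"
proof (induction t)
  case 0
  then show ?case by (simp add: numeral_2_eq_2 power2_eq_square)
next
  case (Suc t)
  define s where "s = real (Suc t)"
  have s: "s \<ge> 1" by (simp add: s_def)
  have "1 / (4 * (s + 1)) \<le> ((2 * s + 1) / (2 * s + 2))\<^sup>2 * (1 / (4 * s))"
    using s by (simp add: divide_simps power2_eq_square) (simp add: algebra_simps)
  also have "\<dots> \<le> ((2 * s + 1) / (2 * s + 2))\<^sup>2 * (line_prob (2 * Suc t) 0)\<^sup>2"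
    using Suc.IH by (intro mult_left_mono) (auto simp: s_def)
  also have "\<dots> = (line_prob (2 * Suc (Suc t)) 0)\<^sup>2"
    by (subst (2) line_prob_double_Suc) (simp add: s_def power_mult_distrib power_divide del: line_prob.simps)
  finally show ?case
    by (simp add: s_def add_ac)
qed

text \<open>Rotated by 45 degrees, the planar walk is a pair of independent simple walks on the line.\<close>

lemma step_prob_eq: "step_prob t x = line_prob t (x $ 1 + x $ 2) * line_prob t (x $ 1 - x $ 2)"
proof (induction t arbitrary: x)
  case 0
  then show ?case by (auto simp: vec_eq_iff forall_2)
next
  case (Suc t)
  \<comment> \<open>A unit step changes both \<open>x $ 1 + x $ 2\<close> and
    \<open>x $ 1 - x $ 2\<close> by 1 up or down; the four steps realise the four pairs of signs, so
    the average factorises.\<close>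
  then show ?case
    by (simp add: sum_unit_steps axis_def algebra_simps add_divide_distrib)
qed

lemma step_prob_nonneg: "0 \<le> step_prob t x"
  by (induction t arbitrary: x) (auto intro!: sum_nonneg)

lemma step_prob_double_ge: "1 / (4 * real (Suc t)) \<le> step_prob (2 * Suc t) 0"
  using line_prob_sqr_ge[of t] by (simp only: step_prob_eq power2_eq_square) simp

text \<open>Recurrence in analytic form: the even times alone contribute at least a quarter of the
  harmonic series.\<close>

lemma sum_step_prob_unbounded: "\<exists>T. B < (\<Sum>t<T. step_prob t 0)"
proof (rule ccontr)
  assume "\<not> ?thesis"
  then have B: "(\<Sum>t<T. step_prob t 0) \<le> B" for T
    by (simp add: not_less)
  have "(\<Sum>t<T. 1 / (4 * real (Suc t))) \<le> B" for T
  proof -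
    have "(\<Sum>t<T. 1 / (4 * real (Suc t))) \<le> (\<Sum>t<T. step_prob (2 * Suc t) 0)"
      by (intro sum_mono step_prob_double_ge)
    also have "\<dots> = (\<Sum>t\<in>(\<lambda>t. 2 * Suc t) ` {..<T}. step_prob t 0)"
      by (subst sum.reindex) (auto simp: inj_on_def)
    also have "\<dots> \<le> (\<Sum>t<2 * T + 1. step_prob t 0)"
      by (intro sum_mono2) (auto simp: step_prob_nonneg)
    also have "\<dots> \<le> B" by (rule B)
    finally show ?thesis .
  qed
  then have "summable (\<lambda>t. 1 / (4 * real (Suc t)))"
    by (intro summableI_nonneg_bounded) auto
  then have "summable (\<lambda>t. 4 * (1 / (4 * real (Suc t))))"
    by (rule summable_mult)
  then have "summable (\<lambda>t. inverse (real (Suc t)))"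
    by (simp add: divide_simps del: of_nat_Suc)
  then have "summable (\<lambda>t. inverse (real t))"
    by (subst (asm) summable_Suc_iff)
  then show False
    using not_summable_harmonic[where 'a = real] by simp
qed

section \<open>The walk killed at its return to the origin\<close>

text \<open>The probability of being at \<open>x\<close> at time \<open>t\<close> with no return to
  the origin at times 1 to \<open>t\<close>; \<open>prob_survive_at\<close> justifies this
  reading.\<close>

primrec taboo_prob :: "nat \<Rightarrow> int ^ 2 \<Rightarrow> real" where
  "taboo_prob 0 x = of_bool (x = 0)"
| "taboo_prob (Suc t) x = (if x = 0 then 0 else (\<Sum>u\<in>unit_steps. taboo_prob t (x - u)) / 4)"

lemma taboo_prob_nonneg: "0 \<le> taboo_prob t x"
  by (induction t arbitrary: x) (auto intro!: sum_nonneg)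

text \<open>The partial sums satisfy the same recursion as the probabilities of hitting a point
  within a given time.\<close>

lemma sum_taboo_prob_Suc:
  "(\<Sum>t<Suc (Suc T). taboo_prob t x) =
    (if x = 0 then 1 else (\<Sum>u\<in>unit_steps. \<Sum>t<Suc T. taboo_prob t (x - u)) / 4)"
proof -
  have "(\<Sum>t<Suc (Suc T). taboo_prob t x) = taboo_prob 0 x + (\<Sum>t<Suc T. taboo_prob (Suc t) x)"
    by (rule sum.lessThan_Suc_shift)
  also have "(\<Sum>t<Suc T. taboo_prob (Suc t) x) =
      (if x = 0 then 0 else (\<Sum>u\<in>unit_steps. \<Sum>t<Suc T. taboo_prob t (x - u)) / 4)"
    by (subst sum.swap) (auto simp: sum_divide_distrib[symmetric] simp del: sum.lessThan_Suc)
  finally show ?thesis by simp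
qed

text \<open>The recursion gives 1 or an average of shorter sums, so the bound is inherited. It makes
  the series over time converge.\<close>

lemma sum_taboo_prob_le_1: "(\<Sum>t<Suc T. taboo_prob t x) \<le> 1"
proof (induction T arbitrary: x)
  case 0
  then show ?case by simp
next
  case (Suc T)
  have "(\<Sum>u\<in>unit_steps. \<Sum>t<Suc T. taboo_prob t (x - u)) \<le> (\<Sum>u\<in>unit_steps. 1)"
    by (intro sum_mono Suc.IH)
  then show ?case
    unfolding sum_taboo_prob_Suc by (simp add: card_unit_steps)
qed

text \<open>The Green function of the killed walk: the expected number of visits before the return,
  with the start at time 0 counted.\<close>

definition green :: "int ^ 2 \<Rightarrow> real" where
  "green x = (\<Sum>t. taboo_prob t x)"

lemma summable_taboo_prob: "summable (\<lambda>t. taboo_prob t x)"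
proof (rule summableI_nonneg_bounded)
  show "(\<Sum>t<T. taboo_prob t x) \<le> 1" for T
    using sum_taboo_prob_le_1[of x "T - 1"] by (cases T) auto
qed (rule taboo_prob_nonneg)

lemma sums_green: "(\<lambda>t. taboo_prob t x) sums green x"
  unfolding green_def by (rule summable_sums[OF summable_taboo_prob])

lemma green_le_1: "green x \<le> 1"
  unfolding green_def
proof (rule suminf_le_const[OF summable_taboo_prob])
  show "(\<Sum>t<T. taboo_prob t x) \<le> 1" for T
    using sum_taboo_prob_le_1[of x "T - 1"] by (cases T) auto
qed

lemma taboo_prob_0_right: "taboo_prob t 0 = of_bool (t = 0)"
  by (cases t) auto

lemma green_0: "green 0 = 1"
proof -
  have "(\<lambda>t. taboo_prob t 0) sums 1"
    using sums_single[of 0 "\<lambda>_. 1 :: real"] by (simp add: taboo_prob_0_right of_bool_def)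
  then show ?thesis
    using sums_green sums_unique2 by blast
qed

text \<open>Sums the recursion of \<open>taboo_prob\<close> over time; off the origin the term at
  time 0 vanishes, so the shift of index loses nothing.\<close>

lemma green_harmonic:
  assumes "x \<noteq> 0"
  shows "green x = (\<Sum>u\<in>unit_steps. green (x - u)) / 4"
proof -
  have "(\<lambda>t. (\<Sum>u\<in>unit_steps. taboo_prob t (x - u)) / 4) sums ((\<Sum>u\<in>unit_steps. green (x - u)) / 4)"
    by (intro sums_divide sums_sum sums_green)
  then have "(\<lambda>t. taboo_prob (Suc t) x) sums ((\<Sum>u\<in>unit_steps. green (x - u)) / 4)"
    using assms by simp
  then have "(\<lambda>t. taboo_prob t x) sums ((\<Sum>u\<in>unit_steps. green (x - u)) / 4)"
    using assms by (subst (asm) sums_Suc_iff) simp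
  then show ?thesis
    using sums_green sums_unique2 by blast
qed

text \<open>Decomposition at the last visit to the origin.\<close>

lemma step_prob_last_visit:
  "step_prob t x = (\<Sum>s\<le>t. step_prob s 0 * taboo_prob (t - s) x)"
proof (induction t arbitrary: x)
  case 0
  then show ?case by simp
next
  case (Suc t)
  show ?case
  proof (cases "x = 0")
    case True
    \<comment> \<open>At the origin only the term \<open>s = Suc t\<close> survives.\<close>
    then show ?thesis
      by (simp add: taboo_prob_0_right Suc_diff_le)
  next
    case False
    have "step_prob (Suc t) x = (\<Sum>u\<in>unit_steps. \<Sum>s\<le>t. step_prob s 0 * taboo_prob (t - s) (x - u)) / 4"
      unfolding step_prob.simps Suc.IH[of "x - _"] ..
    also have "\<dots> = (\<Sum>s\<le>t. step_prob s 0 * ((\<Sum>u\<in>unit_steps. taboo_prob (t - s) (x - u)) / 4))"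
      by (subst sum.swap) (simp add: sum_divide_distrib sum_distrib_left)
    also have "\<dots> = (\<Sum>s\<le>t. step_prob s 0 * taboo_prob (Suc t - s) x)"
      using False by (intro sum.cong) (auto simp: Suc_diff_le)
    \<comment> \<open>The remaining term \<open>s = Suc t\<close> vanishes because
      \<open>taboo_prob 0 x = 0\<close> off the origin.\<close>
    finally show ?thesis
      using False by simp
  qed
qed

text \<open>The left-hand side is the probability that the walk returns to the origin.\<close>

lemma green_harmonic_0: "(\<Sum>u\<in>unit_steps. green (0 - u)) / 4 = 1"
proof (rule ccontr)
  \<comment> \<open>\<open>r t\<close> is the probability of a first return at time
    \<open>Suc t\<close>, \<open>c\<close> that of ever returning, and \<open>P T\<close> the
    expected number of visits to the origin at times below \<open>T\<close>.\<close>
  define c where "c = (\<Sum>u\<in>unit_steps. green (0 - u)) / 4"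
  define r where "r t = (\<Sum>u\<in>unit_steps. taboo_prob t (0 - u)) / 4" for t
  define P where "P T = (\<Sum>t<T. step_prob t 0)" for T
  have r: "r sums c"
    unfolding r_def c_def by (intro sums_divide sums_sum sums_green)
  have r_nonneg: "0 \<le> r t" for t
    unfolding r_def by (auto intro!: sum_nonneg taboo_prob_nonneg)
  have P_nonneg: "0 \<le> P T" for T
    unfolding P_def by (auto intro!: sum_nonneg step_prob_nonneg)
  assume "\<not> (\<Sum>u\<in>unit_steps. green (0 - u)) / 4 = 1"
  moreover have "(\<Sum>u\<in>unit_steps. green (0 - u)) \<le> (\<Sum>u\<in>unit_steps. 1)"
    by (intro sum_mono green_le_1)
  ultimately have c: "c < 1"
    by (simp add: c_def card_unit_steps)
  \<comment> \<open>Split at the last visit to the origin up to time \<open>t\<close>; the rest of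
    the path is then a first return.\<close>
  have renewal: "step_prob (Suc t) 0 = (\<Sum>s\<le>t. step_prob s 0 * r (t - s))" for t
  proof -
    have "step_prob (Suc t) 0
        = (\<Sum>u\<in>unit_steps. \<Sum>s\<le>t. step_prob s 0 * taboo_prob (t - s) (0 - u)) / 4"
      unfolding step_prob.simps step_prob_last_visit[of t "0 - _"] ..
    also have "\<dots> = (\<Sum>s\<le>t. step_prob s 0 * r (t - s))"
      unfolding r_def by (subst sum.swap) (simp add: sum_divide_distrib sum_distrib_left)
    finally show ?thesis .
  qed
  \<comment> \<open>The renewal equation yields \<open>P T \<le> 1 + P T * c\<close>, the geometric
    bound on the visits of a transient walk.\<close>
  have "P T \<le> 1 / (1 - c)" for T
  proof -
    have "P T \<le> P (Suc T)"
      by (simp add: P_def step_prob_nonneg)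
    also have "P (Suc T) = 1 + (\<Sum>t<T. \<Sum>s\<le>t. step_prob s 0 * r (t - s))"
      unfolding P_def by (subst sum.lessThan_Suc_shift) (simp add: renewal del: step_prob.simps(2))
    also have "(\<Sum>t<T. \<Sum>s\<le>t. step_prob s 0 * r (t - s))
        = (\<Sum>(s, t)\<in>{(s, t). s + t < T}. step_prob s 0 * r t)"
      by (rule sum.triangle_reindex[symmetric])
    \<comment> \<open>Enlarging the triangle of index pairs to a square turns the convolution into a
      product.\<close>
    also have "\<dots> \<le> (\<Sum>(s, t)\<in>{..<T} \<times> {..<T}. step_prob s 0 * r t)"
      by (intro sum_mono2) (auto simp: step_prob_nonneg r_nonneg)
    also have "\<dots> = P T * (\<Sum>t<T. r t)"
      by (simp add: P_def sum_product sum.cartesian_product)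
    also have "\<dots> \<le> P T * c"
      using r r_nonneg P_nonneg
      by (intro mult_left_mono) (auto simp: sums_iff intro!: sum_le_suminf)
    finally show ?thesis
      using c by (simp add: field_simps)
  qed
  moreover obtain T where "1 / (1 - c) < P T"
    using sum_step_prob_unbounded unfolding P_def by blast
  ultimately show False
    by (meson not_less)
qed

text \<open>An average of four numbers that are at most 1 equals 1 only if all four do; at the
  origin the averaging property is recurrence.\<close>

lemma green_neighbour:
  assumes "green x = 1" and "u \<in> unit_steps"
  shows "green (x - u) = 1"
proof (rule ccontr)
  assume "green (x - u) \<noteq> 1"
  then have "green (x - u) < 1"
    using green_le_1[of "x - u"] by simp
  then have "(\<Sum>u\<in>unit_steps. green (x - u)) < (\<Sum>u\<in>unit_steps. 1)"
    using assms(2) by (intro sum_strict_mono_ex1 finite_unit_steps) (auto intro: green_le_1)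
  moreover have "green x = (\<Sum>u\<in>unit_steps. green (x - u)) / 4"
    using green_harmonic[of x] green_harmonic_0 assms(1) by (cases "x = 0") auto
  ultimately show False
    using assms(1) by (simp add: card_unit_steps)
qed

lemma int_unit_step_closed:
  fixes k :: int
  assumes "P 0" and "\<And>k. P k \<Longrightarrow> P (k + 1)" and "\<And>k. P k \<Longrightarrow> P (k - 1)"
  shows "P k"
  by (induction k rule: int_induct[of _ 0]) (use assms in auto)

text \<open>The maximum principle: the Green function attains its maximum 1 at the origin.\<close>

lemma green_eq_1: "green x = 1"
proof -
  have step: "green (x + axis i 1) = 1" "green (x - axis i 1) = 1" if "green x = 1" for x i
    using green_neighbour[OF that, of "axis i 1"] green_neighbour[OF that, of "- axis i 1"]
    by (auto simp: unit_steps_def)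
  have line: "green (y + axis i k) = 1" if "green y = 1" for y i and k :: int
  proof (induction k rule: int_unit_step_closed)
    case 1
    have "axis i (0::int) = (0 :: int ^ 2)"
      by (simp add: axis_def vec_eq_iff)
    with that show ?case by (simp only: add_0_right)
  next
    case (2 k)
    have "y + axis i (k + 1) = y + axis i k + axis i 1"
      by (auto simp: axis_def vec_eq_iff)
    then show ?case using step(1)[OF 2] by (simp only:)
  next
    case (3 k)
    have "y + axis i (k - 1) = y + axis i k - axis i 1"
      by (auto simp: axis_def vec_eq_iff)
    then show ?case using step(2)[OF 3] by (simp only:)
  qed
  \<comment> \<open>Every point is reached from the origin along one axis and then along the
    other.\<close>
  have "x = 0 + axis 1 (x $ 1) + axis 2 (x $ 2)"
    by (simp add: vec_eq_iff forall_2 axis_def)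
  then show ?thesis
    using line[OF line[OF green_0]] by metis
qed

section \<open>Expected numbers of visits\<close>

text \<open>Expresses survival through finitely many positions, which makes it measurable. An empty
  infimum is infinite and a nonempty one is attained.\<close>

lemma less_return_time_iff: "enat t < return_time x \<longleftrightarrow> (\<forall>s\<in>{1..t}. x s \<noteq> 0)"
proof -
  have "return_time x \<le> enat t \<longleftrightarrow> (\<exists>s\<in>{1..t}. x s = 0)"
  proof
    assume *: "return_time x \<le> enat t"
    define A where "A = enat ` {t. t \<ge> 1 \<and> x t = 0}"
    have ret: "return_time x = Inf A"
      by (simp add: return_time_def A_def)
    then have "A \<noteq> {}"
      using * by (auto simp: top_enat_def)
    then have "Inf A \<in> A"
      by (auto simp: Inf_enat_def intro: LeastI)
    then show "\<exists>s\<in>{1..t}. x s = 0"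
      using * ret by (auto simp: A_def)
  next
    assume "\<exists>s\<in>{1..t}. x s = 0"
    then obtain s where "1 \<le> s" "s \<le> t" "x s = 0" by auto
    then have "return_time x \<le> enat s"
      unfolding return_time_def by (intro Inf_lower) auto
    with \<open>s \<le> t\<close> show "return_time x \<le> enat t"
      by (meson enat_ord_simps(1) order_trans)
  qed
  then show ?thesis
    by (auto simp: not_le[symmetric])
qed

text \<open>Taking coordinates, \<open>\<lambda>i f. f i\<close>, as increments makes the walk a
  function on the product space of the first \<open>t\<close> steps, where independence
  applies.\<close>

lemma walk_restrict:
  "s \<le> t \<Longrightarrow> walk (\<lambda>i f. f i) (\<lambda>i\<in>{1..t}. e i \<omega>) s = walk e \<omega> s"
  by (induction s) auto

text \<open>\<open>N\<close> is arbitrary so as to cover both the probability space and the product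
  space of increments.\<close>

lemma measurable_walk:
  assumes "\<And>i. i \<in> {1..t} \<Longrightarrow> e i \<in> N \<rightarrow>\<^sub>M count_space UNIV" and "s \<le> t"
  shows "(\<lambda>\<omega>. walk e \<omega> s) \<in> N \<rightarrow>\<^sub>M count_space UNIV"
  using assms(2)
proof (induction s)
  case 0
  then show ?case by simp
next
  case (Suc s)
  \<comment> \<open>The position at time \<open>s\<close> takes countably many values
    \<open>a\<close>, so each can be treated separately.\<close>
  have "(\<lambda>\<omega>. a + e (Suc s) \<omega>) \<in> N \<rightarrow>\<^sub>M count_space UNIV" for a
    using Suc.prems by (intro measurable_compose[OF assms(1)]) auto
  moreover have "(\<lambda>\<omega>. walk e \<omega> s) \<in> N \<rightarrow>\<^sub>M count_space UNIV"
    using Suc by simp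
  ultimately show ?case
    unfolding walk.simps by (rule measurable_compose_countable)
qed

section \<open>Taboo probabilities as probabilities of path events\<close>

context simple_random_walk
begin

lemma measurable_step: "1 \<le> t \<Longrightarrow> e t \<in> M \<rightarrow>\<^sub>M count_space UNIV"
  using indep_steps by (auto simp: indep_vars_def)

lemma prob_step:
  assumes "1 \<le> t" and "u \<in> unit_steps"
  shows "prob {\<omega> \<in> space M. e t \<omega> = u} = 1 / 4"
proof -
  have "prob {\<omega> \<in> space M. e t \<omega> = u} = measure (distr M (count_space UNIV) (e t)) {u}"
    using measurable_step[OF assms(1)]
    by (subst measure_distr) (auto intro!: arg_cong[where f = prob])
  also have "\<dots> = 1 / 4"
    using assms by (simp add: uniform_steps measure_pmf_single finite_unit_steps
        unit_steps_nonempty card_unit_steps)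
  finally show ?thesis .
qed

lemma AE_step: "1 \<le> t \<Longrightarrow> AE \<omega> in M. e t \<omega> \<in> unit_steps"
proof -
  assume t: "1 \<le> t"
  have "AE u in distr M (count_space UNIV) (e t). u \<in> unit_steps"
    unfolding uniform_steps[OF t]
    by (auto simp: AE_measure_pmf_iff finite_unit_steps unit_steps_nonempty)
  then show ?thesis
    using measurable_step[OF t] by (simp add: AE_distr_iff)
qed

text \<open>The event of probability \<open>taboo_prob t x\<close>; time 0 is left out, so the start
  is not a return.\<close>

definition survive_at :: "nat \<Rightarrow> int ^ 2 \<Rightarrow> 'a set" where
  "survive_at t x = {\<omega> \<in> space M. walk e \<omega> t = x \<and> (\<forall>s\<in>{1..t}. walk e \<omega> s \<noteq> 0)}"

lemma sets_survive_at [measurable]: "survive_at t x \<in> sets M"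
proof -
  have [measurable]: "(\<lambda>\<omega>. walk e \<omega> s) \<in> M \<rightarrow>\<^sub>M count_space UNIV" for s
    by (rule measurable_walk[OF measurable_step]) auto
  show ?thesis
    unfolding survive_at_def by measurable
qed

text \<open>Survival up to \<open>t\<close> is determined by the first \<open>t\<close> increments,
  which are independent of the next one.\<close>

lemma prob_survive_step:
  assumes "u \<in> unit_steps"
  shows "prob (survive_at t x \<inter> {\<omega> \<in> space M. e (Suc t) \<omega> = u}) = prob (survive_at t x) / 4"
proof -
  let ?N = "\<lambda>I. PiM I (\<lambda>_. count_space UNIV :: (int ^ 2) measure)"
  \<comment> \<open>Both events are rewritten as sets of increment sequences, so that independence
    of disjoint blocks of increments applies.\<close>
  define A where "A = {f \<in> space (?N {1..t}). walk (\<lambda>i f. f i) f t = x \<and>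
    (\<forall>s\<in>{1..t}. walk (\<lambda>i f. f i) f s \<noteq> 0)}"
  define B where "B = {f \<in> space (?N {Suc t}). f (Suc t) = u}"
  have walk: "(\<lambda>f. walk (\<lambda>i f. f i) f s) \<in> ?N {1..t} \<rightarrow>\<^sub>M count_space UNIV" if "s \<le> t" for s
    using that by (intro measurable_walk measurable_component_singleton) auto
  have level: "{f \<in> space (?N {1..t}). walk (\<lambda>i f. f i) f s = y} \<in> sets (?N {1..t})"
    if "s \<le> t" for s y
    by (rule predE, rule measurable_compose[OF walk[OF that], where g = "\<lambda>z. z = y"]) simp
  have A: "A \<in> sets (?N {1..t})"
    unfolding A_def
    by (intro sets.sets_Collect_conj sets.sets_Collect_finite_All sets.sets_Collect_neg level) auto
  have B: "B \<in> sets (?N {Suc t})"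
    unfolding B_def by measurable
  have "prob ((\<lambda>\<omega>. (\<lambda>i\<in>{1..t}. e i \<omega>, \<lambda>i\<in>{Suc t}. e i \<omega>)) -` (A \<times> B) \<inter> space M) =
      prob ((\<lambda>\<omega>. \<lambda>i\<in>{1..t}. e i \<omega>) -` A \<inter> space M) *
      prob ((\<lambda>\<omega>. \<lambda>i\<in>{Suc t}. e i \<omega>) -` B \<inter> space M)"
    by (rule indep_varD[OF indep_var_restrict[OF indep_steps] A B]) auto
  moreover have "(\<lambda>\<omega>. \<lambda>i\<in>{1..t}. e i \<omega>) -` A \<inter> space M = survive_at t x"
    by (auto simp: A_def survive_at_def space_PiM walk_restrict[unfolded One_nat_def])
  moreover have "(\<lambda>\<omega>. \<lambda>i\<in>{Suc t}. e i \<omega>) -` B \<inter> space M = {\<omega> \<in> space M. e (Suc t) \<omega> = u}"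
    by (auto simp: B_def space_PiM)
  moreover have "(\<lambda>\<omega>. (\<lambda>i\<in>{1..t}. e i \<omega>, \<lambda>i\<in>{Suc t}. e i \<omega>)) -` (A \<times> B) \<inter> space M =
      survive_at t x \<inter> {\<omega> \<in> space M. e (Suc t) \<omega> = u}"
    by (auto simp: A_def B_def survive_at_def space_PiM walk_restrict[unfolded One_nat_def])
  ultimately show ?thesis
    using prob_step[of "Suc t" u] assms by simp
qed

text \<open>Splits by the last increment: as \<open>x\<close> is not the origin, arriving there
  keeps the walk alive. The predicate \<open>Q\<close> on the previous position covers the recursion
  of \<open>taboo_prob\<close> and the outward and inward visits alike.\<close>

lemma prob_survive_Suc:
  assumes "x \<noteq> 0"
  shows "prob {\<omega> \<in> survive_at (Suc t) x. Q (walk e \<omega> t)} =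
    (\<Sum>u | u \<in> unit_steps \<and> Q (x - u). prob (survive_at t (x - u))) / 4"
proof -
  let ?U = "{u \<in> unit_steps. Q (x - u)}"
  let ?E = "\<lambda>u. survive_at t (x - u) \<inter> {\<omega> \<in> space M. e (Suc t) \<omega> = u}"
  have [measurable]: "(\<lambda>\<omega>. walk e \<omega> s) \<in> M \<rightarrow>\<^sub>M count_space UNIV" for s
    by (rule measurable_walk[OF measurable_step]) auto
  have [measurable]: "e (Suc t) \<in> M \<rightarrow>\<^sub>M count_space UNIV"
    by (rule measurable_step) simp
  have E: "?E u \<in> sets M" for u
    by measurable
  have "prob {\<omega> \<in> survive_at (Suc t) x. Q (walk e \<omega> t)} = prob (\<Union>u\<in>?U. ?E u)"
  proof (rule finite_measure_eq_AE)
    have "{\<omega> \<in> survive_at (Suc t) x. Q (walk e \<omega> t)} = survive_at (Suc t) x \<inter> {\<omega> \<in> space M. Q (walk e \<omega> t)}"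
      by (auto simp: survive_at_def)
    also have "\<dots> \<in> sets M" by measurable
    finally show "{\<omega> \<in> survive_at (Suc t) x. Q (walk e \<omega> t)} \<in> sets M" .
    show "(\<Union>u\<in>?U. ?E u) \<in> sets M"
      using E by (intro sets.finite_UN) (auto simp: finite_unit_steps)
    \<comment> \<open>The two events agree only almost surely, because increments outside
      \<open>unit_steps\<close> are merely of probability 0.\<close>
    show "AE \<omega> in M. \<omega> \<in> {\<omega> \<in> survive_at (Suc t) x. Q (walk e \<omega> t)} \<longleftrightarrow> \<omega> \<in> (\<Union>u\<in>?U. ?E u)"
      using AE_step[of "Suc t", simplified]
    proof eventually_elim
      case (elim \<omega>)
      then show ?case
        using assms by (auto simp: survive_at_def atLeastAtMostSuc_conv algebra_simps)
    qed
  qed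
  also have "\<dots> = (\<Sum>u\<in>?U. prob (?E u))"
    by (rule finite_measure_finite_Union) (use E in \<open>auto simp: finite_unit_steps disjoint_family_on_def\<close>)
  also have "\<dots> = (\<Sum>u\<in>?U. prob (survive_at t (x - u)) / 4)"
    by (intro sum.cong prob_survive_step) auto
  finally show ?thesis
    by (simp add: sum_divide_distrib)
qed

lemma prob_survive_at: "prob (survive_at t x) = taboo_prob t x"
proof (induction t arbitrary: x)
  case 0
  have "survive_at 0 x = (if x = 0 then space M else {})"
    by (auto simp: survive_at_def)
  then show ?case by (simp add: prob_space)
next
  case (Suc t)
  show ?case
  proof (cases "x = 0")
    case True
    then have "survive_at (Suc t) x = {}"
      by (auto simp: survive_at_def atLeastAtMostSuc_conv)
    with True show ?thesis by simp
  next
    case False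
    then show ?thesis
      using prob_survive_Suc[OF False, of t "\<lambda>_. True"] Suc.IH by simp
  qed
qed

text \<open>Surviving to time \<open>Suc t\<close> and then entering \<open>z\<close> by the step
  \<open>u\<close> has probability \<open>taboo_prob t (z - u) / 4\<close>; summed over time this is
  \<open>green (z - u) / 4\<close>, so every admissible pair of \<open>z\<close> and
  \<open>u\<close> contributes 1/4.\<close>

lemma nn_integral_visits_from:
  assumes "finite Z" and "0 \<notin> Z"
  shows "(\<integral>\<^sup>+\<omega>. emeasure (count_space UNIV) {t. 0 < t \<and> enat t < return_time (walk e \<omega>) \<and>
      walk e \<omega> t \<in> Z \<and> Q (walk e \<omega> (t - 1))} \<partial>M) =
    ennreal (\<Sum>z\<in>Z. real (card {u \<in> unit_steps. Q (z - u)}) / 4)"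
proof -
  have [measurable]: "(\<lambda>\<omega>. walk e \<omega> s) \<in> M \<rightarrow>\<^sub>M count_space UNIV" for s
    by (rule measurable_walk[OF measurable_step]) auto
  define E where "E t = {\<omega> \<in> space M. 0 < t \<and> walk e \<omega> t \<in> Z \<and>
    (\<forall>s\<in>{1..t}. walk e \<omega> s \<noteq> 0) \<and> Q (walk e \<omega> (t - 1))}" for t
  have E [measurable]: "E t \<in> sets M" for t
    unfolding E_def by measurable
  have prob_E: "prob (E (Suc t)) =
      (\<Sum>z\<in>Z. (\<Sum>u | u \<in> unit_steps \<and> Q (z - u). taboo_prob t (z - u)) / 4)" for t
  proof -
    let ?F = "\<lambda>z. {\<omega> \<in> survive_at (Suc t) z. Q (walk e \<omega> t)}"
    have F: "?F z \<in> sets M" for z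
    proof -
      have "?F z = survive_at (Suc t) z \<inter> {\<omega> \<in> space M. Q (walk e \<omega> t)}"
        by (auto simp: survive_at_def)
      also have "\<dots> \<in> sets M" by measurable
      finally show ?thesis .
    qed
    have "E (Suc t) = (\<Union>z\<in>Z. ?F z)"
      by (auto simp: E_def survive_at_def)
    then have "prob (E (Suc t)) = (\<Sum>z\<in>Z. prob (?F z))"
      using F assms(1)
      by (simp only:) (intro finite_measure_finite_Union, auto simp: disjoint_family_on_def survive_at_def)
    also have "\<dots> = (\<Sum>z\<in>Z. (\<Sum>u | u \<in> unit_steps \<and> Q (z - u). taboo_prob t (z - u)) / 4)"
      using assms(2) by (intro sum.cong refl, subst prob_survive_Suc) (auto simp: prob_survive_at)
    finally show ?thesis .
  qed
  have "(\<lambda>t. prob (E (Suc t))) sums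
      (\<Sum>z\<in>Z. (\<Sum>u | u \<in> unit_steps \<and> Q (z - u). green (z - u)) / 4)"
    unfolding prob_E by (intro sums_sum sums_divide sums_green)
  \<comment> \<open>Starting the series at time 0 adds nothing, since \<open>E\<close> demands
    \<open>0 < t\<close>.\<close>
  moreover have "prob (E 0) = 0"
    by (simp add: E_def)
  ultimately have sums: "(\<lambda>t. prob (E t)) sums (\<Sum>z\<in>Z. real (card {u \<in> unit_steps. Q (z - u)}) / 4)"
    by (subst (asm) sums_Suc_iff) (simp add: green_eq_1)
  \<comment> \<open>The count is a series of indicators, so its expectation is the series of their
    probabilities.\<close>
  have "(\<integral>\<^sup>+\<omega>. emeasure (count_space UNIV) {t. 0 < t \<and> enat t < return_time (walk e \<omega>) \<and>
      walk e \<omega> t \<in> Z \<and> Q (walk e \<omega> (t - 1))} \<partial>M) = (\<integral>\<^sup>+\<omega>. (\<Sum>t. indicator (E t) \<omega>) \<partial>M)"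
  proof (rule nn_integral_cong)
    fix \<omega> assume "\<omega> \<in> space M"
    let ?T = "{t. 0 < t \<and> enat t < return_time (walk e \<omega>) \<and> walk e \<omega> t \<in> Z \<and> Q (walk e \<omega> (t - 1))}"
    have "emeasure (count_space UNIV) ?T = (\<integral>\<^sup>+t. indicator ?T t \<partial>count_space UNIV)"
      by simp
    also have "\<dots> = (\<Sum>t. indicator ?T t)"
      by (rule nn_integral_count_space_nat)
    also have "\<dots> = (\<Sum>t. indicator (E t) \<omega>)"
      using \<open>\<omega> \<in> space M\<close>
      by (intro suminf_cong) (auto simp: E_def less_return_time_iff indicator_def)
    finally show "emeasure (count_space UNIV) ?T = (\<Sum>t. indicator (E t) \<omega>)" .
  qed
  also have "\<dots> = (\<Sum>t. ennreal (prob (E t)))"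
    by (subst nn_integral_suminf) (auto simp: emeasure_eq_measure)
  also have "\<dots> = ennreal (\<Sum>z\<in>Z. real (card {u \<in> unit_steps. Q (z - u)}) / 4)"
    using sums by (intro suminf_ennreal_eq) auto
  finally show ?thesis .
qed

end

section \<open>Norms of neighbours and sign classes\<close>

lemma l1_norm_2: "l1_norm n = \<bar>n $ 1\<bar> + \<bar>n $ 2\<bar>"
  by (simp add: l1_norm_def sum_2)

lemma zero_count_eq: "zero_count n = of_bool (n $ 1 = 0) + of_bool (n $ 2 = 0)"
proof -
  have "zero_count n = (\<Sum>i\<in>UNIV. of_bool (n $ i = 0))"
    by (simp add: zero_count_def sum_of_bool_eq)
  then show ?thesis by (simp add: sum_2)
qed

lemma card_unit_steps_Collect:
  "card {u \<in> unit_steps. P u} = (\<Sum>u\<in>unit_steps. of_bool (P u))"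
  by (simp add: sum_of_bool_eq finite_unit_steps Collect_conj_eq Int_commute)

text \<open>Along a nonzero coordinate one of the two steps lowers the norm and the other raises it;
  along a zero coordinate both raise it.\<close>

lemma card_inner_neighbours:
  "card {u \<in> unit_steps. l1_norm (n - u) = l1_norm n - 1} = 2 - zero_count n"
  by (auto simp: card_unit_steps_Collect sum_unit_steps l1_norm_2 zero_count_eq axis_def of_bool_def)

lemma card_outer_neighbours:
  "card {u \<in> unit_steps. l1_norm (n - u) = l1_norm n + 1} = 2 + zero_count n"
  by (auto simp: card_unit_steps_Collect sum_unit_steps l1_norm_2 zero_count_eq axis_def of_bool_def)

lemma mem_sign_class_iff: "m \<in> sign_class n \<longleftrightarrow> \<bar>m $ 1\<bar> = \<bar>n $ 1\<bar> \<and> \<bar>m $ 2\<bar> = \<bar>n $ 2\<bar>"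
  by (simp add: sign_class_def abs_vec_def vec_eq_iff forall_2)

lemma sign_class_eq_image:
  "sign_class n = (\<lambda>(a, b). vector [a, b]) ` ({n $ 1, - n $ 1} \<times> {n $ 2, - n $ 2})"
proof (intro set_eqI iffI)
  fix m assume "m \<in> sign_class n"
  then have "m = vector [m $ 1, m $ 2]" "m $ 1 \<in> {n $ 1, - n $ 1}" "m $ 2 \<in> {n $ 2, - n $ 2}"
    by (auto simp: mem_sign_class_iff vec_eq_iff forall_2 abs_eq_iff)
  then show "m \<in> (\<lambda>(a, b). vector [a, b]) ` ({n $ 1, - n $ 1} \<times> {n $ 2, - n $ 2})"
    by (metis (no_types, lifting) SigmaI case_prod_conv image_eqI)
qed (auto simp: mem_sign_class_iff)

lemma finite_sign_class: "finite (sign_class n)"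
  unfolding sign_class_eq_image by simp

text \<open>A nonzero coordinate has two choices of sign, a zero coordinate only one.\<close>

lemma card_sign_class: "card (sign_class n) = 2 ^ (2 - zero_count n)"
proof -
  have "inj_on (\<lambda>(a, b). vector [a, b] :: int ^ 2) A" for A
    by (auto simp: inj_on_def vec_eq_iff forall_2)
  then have "card (sign_class n) = card {n $ 1, - n $ 1} * card {n $ 2, - n $ 2}"
    unfolding sign_class_eq_image by (simp only: card_image card_cartesian_product)
  moreover have "card {a, - a} = (if a = 0 then 1 else 2)" for a :: int
    by auto
  ultimately show ?thesis
    by (simp add: zero_count_eq)
qed

lemma set_norm_eq:
  assumes "Z \<noteq> {}" and "\<And>z. z \<in> Z \<Longrightarrow> l1_norm z = r"
  shows "set_norm Z = r"
  unfolding set_norm_def using assms by (intro the_equality) auto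

lemma
  assumes "m \<in> sign_class n"
  shows l1_norm_sign_class: "l1_norm m = l1_norm n"
    and zero_count_sign_class: "zero_count m = zero_count n"
  using assms by (auto simp: mem_sign_class_iff l1_norm_2 zero_count_eq)

section \<open>Expected visits to a set of states\<close>

context simple_random_walk
begin

context
  fixes Z :: "(int ^ 2) set" and r :: int and d :: nat
  assumes Z: "finite Z" "Z \<noteq> {}" "0 \<notin> Z"
    and norm: "\<And>z. z \<in> Z \<Longrightarrow> l1_norm z = r"
    and zeros: "\<And>z. z \<in> Z \<Longrightarrow> zero_count z = d"
begin

lemma set_norm_Z: "set_norm Z = r"
  using Z(2) norm by (rule set_norm_eq)

text \<open>Both \<open>{n}\<close> and \<open>sign_class n\<close> have constant norm and zero
  count, so all their points have equally many inner neighbours and contribute equally.\<close>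

lemma nn_integral_outward_visits:
  "(\<integral>\<^sup>+\<omega>. outward_visits (walk e \<omega>) Z \<partial>M) = ennreal (card Z * (real (2 - d) / 4))"
proof -
  have "card {u \<in> unit_steps. l1_norm (z - u) = r - 1} = 2 - d" if "z \<in> Z" for z
    using card_inner_neighbours[of z] norm[OF that] zeros[OF that] by simp
  then show ?thesis
    unfolding outward_visits_def set_norm_Z
    by (subst nn_integral_visits_from[OF Z(1,3)]) simp_all
qed

lemma nn_integral_inward_visits:
  "(\<integral>\<^sup>+\<omega>. inward_visits (walk e \<omega>) Z \<partial>M) = ennreal (card Z * (real (2 + d) / 4))"
proof -
  have "card {u \<in> unit_steps. l1_norm (z - u) = r + 1} = 2 + d" if "z \<in> Z" for z
    using card_outer_neighbours[of z] norm[OF that] zeros[OF that] by simp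
  then show ?thesis
    unfolding inward_visits_def set_norm_Z
    by (subst nn_integral_visits_from[OF Z(1,3)]) simp_all
qed

end

lemma nn_integral_visits:
  "finite Z \<Longrightarrow> 0 \<notin> Z \<Longrightarrow> (\<integral>\<^sup>+\<omega>. visits (walk e \<omega>) Z \<partial>M) = ennreal (card Z)"
  using nn_integral_visits_from[of Z "\<lambda>_. True"] by (simp add: visits_def card_unit_steps)

end

theorem theorem3p6:
  fixes M :: "'a measure" and e :: "nat \<Rightarrow> 'a \<Rightarrow> int ^ 2" and n :: "int ^ 2"
  assumes "simple_random_walk M e"
    and "n \<noteq> 0"
  shows "(\<integral>\<^sup>+\<omega>. outward_visits (walk e \<omega>) {n} \<partial>M) =
      ennreal (2 powi (int (zero_count n) - 2)) * (\<integral>\<^sup>+\<omega>. outward_visits (walk e \<omega>) (sign_class n) \<partial>M) \<and>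
     ennreal (2 powi (int (zero_count n) - 2)) * (\<integral>\<^sup>+\<omega>. outward_visits (walk e \<omega>) (sign_class n) \<partial>M) =
      ennreal ((2 - real (zero_count n)) / 4) \<and>
     (\<integral>\<^sup>+\<omega>. inward_visits (walk e \<omega>) {n} \<partial>M) =
      ennreal (2 powi (int (zero_count n) - 2)) * (\<integral>\<^sup>+\<omega>. inward_visits (walk e \<omega>) (sign_class n) \<partial>M) \<and>
     ennreal (2 powi (int (zero_count n) - 2)) * (\<integral>\<^sup>+\<omega>. inward_visits (walk e \<omega>) (sign_class n) \<partial>M) =
      ennreal ((2 + real (zero_count n)) / 4) \<and>
     (\<integral>\<^sup>+\<omega>. visits (walk e \<omega>) {n} \<partial>M) =
      ennreal (2 powi (int (zero_count n) - 2)) * (\<integral>\<^sup>+\<omega>. visits (walk e \<omega>) (sign_class n) \<partial>M) \<and>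
     ennreal (2 powi (int (zero_count n) - 2)) * (\<integral>\<^sup>+\<omega>. visits (walk e \<omega>) (sign_class n) \<partial>M) =
      1"
proof -
  interpret simple_random_walk M e by fact
  define d where "d = zero_count n"
  have d: "d \<le> 2"
    by (simp add: d_def zero_count_eq of_bool_def)
  have cls: "finite (sign_class n)" "sign_class n \<noteq> {}" "0 \<notin> sign_class n"
    using assms(2) finite_sign_class by (auto simp: mem_sign_class_iff vec_eq_iff forall_2)
  \<comment> \<open>The power of 2 is the inverse of \<open>card (sign_class n)\<close>, and each
    expectation for the class is that cardinality times the one for a single state.\<close>
  have scale: "ennreal (2 powi (int d - 2)) * ennreal (card (sign_class n) * a) = ennreal a"
    if "0 \<le> a" for a :: real
  proof -
    have "2 powi (int d - 2) * (card (sign_class n) * a) = a"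
      using d by (auto simp: card_sign_class d_def[symmetric] le_Suc_eq numeral_2_eq_2 power_int_def)
    then show ?thesis
      using that by (simp add: ennreal_mult'[symmetric])
  qed
  \<comment> \<open>Truncated subtraction agrees with real subtraction because
    \<open>d \<le> 2\<close>.\<close>
  have r: "real (2 - d) = 2 - real d"
    using d by simp
  show ?thesis
    unfolding d_def[symmetric]
    using nn_integral_outward_visits[of "{n}" "l1_norm n" d]
      nn_integral_outward_visits[OF cls l1_norm_sign_class zero_count_sign_class]
      nn_integral_inward_visits[of "{n}" "l1_norm n" d]
      nn_integral_inward_visits[OF cls l1_norm_sign_class zero_count_sign_class]
      nn_integral_visits[of "{n}"] nn_integral_visits[OF cls(1,3)]
      scale[of "real (2 - d) / 4"] scale[of "real (2 + d) / 4"] scale[of 1] assms(2) r d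
    by (simp add: d_def[symmetric])
qed

end
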